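(* Let $k\ge1$. Then $H_{\frac{f_{2k+1}}{2}+1,\,f_{2k+3}-1}=(-1)^{k+1}\frac{f_{2k+1}}{2}$.
   Context: Let $\tau$ be the substitution on $\{0,1\}$ with $\tau(1)=101$, $\tau(0)=1$ (extended to words by concatenation), and let $\mathbf{s}=(s_j)_{j\ge 0}=\lim_{j\to\infty}\tau^j(1)$ be its fixed point beginning with $1$. For $m\ge 0$, $n\ge 1$, $H_{m,n}=\det(s_{m+i+j})_{0\le i,j\le n-1}$. Define $f_{2j}=|\tau^j(1)|$, $f_{2j+1}=|\tau^j(10)|$ ($|w|$ = length of $w$); equivalently $f_0=1$, $f_1=2$, $f_{2j+2}=f_{2j}+f_{2j+1}$, $f_{2j+3}=f_{2j}+f_{2j+2}$; the $f_{2j+1}$ are even. *)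

theory Defs
  imports "Jordan_Normal_Form.Determinant"
begin

(* The letters 1 and 0 are represented by True and False. *)

fun tau_letter :: "bool \<Rightarrow> bool list" where
  "tau_letter True = [True, False, True]"
| "tau_letter False = [True]"

definition tau :: "bool list \<Rightarrow> bool list" where
  "tau w = concat (map tau_letter w)"

(* The limit word: the words tau^j(1) extend one another and have length greater than j
   (tau_pow_prefix, tau_pow_length below), so its letter at position j can be read off
   from tau^j(1);
   see s_limit and s_fixed_point. *)
definition s_letter :: "nat \<Rightarrow> bool" where
  "s_letter j = (tau ^^ j) [True] ! j"

definition s_seq :: "nat \<Rightarrow> int" where
  "s_seq j = of_bool (s_letter j)"

definition hankel :: "nat \<Rightarrow> nat \<Rightarrow> int" where
  "hankel m n = det (mat n n (\<lambda>(i, j). s_seq (m + i + j)))"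

definition f_seq :: "nat \<Rightarrow> nat" where
  "f_seq n = length ((tau ^^ (n div 2)) (if even n then [True] else [True, False]))"

lemma tau_simps [simp]:
  "tau [] = []"
  "tau (a # w) = tau_letter a @ tau w"
  "tau (v @ w) = tau v @ tau w"
  by (simp_all add: tau_def)

lemma tau_pow_append: "(tau ^^ j) (v @ w) = (tau ^^ j) v @ (tau ^^ j) w"
  by (induction j) simp_all

lemma tau_pow_1: "(tau ^^ Suc j) [True] = (tau ^^ j) [True] @ (tau ^^ j) [False] @ (tau ^^ j) [True]"
proof -
  have "(tau ^^ Suc j) [True] = (tau ^^ j) ([True] @ [False] @ [True])"
    by (simp add: funpow_Suc_right del: funpow.simps)
  then show ?thesis by (simp only: tau_pow_append)
qed

lemma tau_pow_0: "(tau ^^ Suc j) [False] = (tau ^^ j) [True]"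
  by (simp add: funpow_Suc_right del: funpow.simps)

lemma f_even: "f_seq (2 * j) = length ((tau ^^ j) [True])"
  and f_odd: "f_seq (2 * j + 1) = length ((tau ^^ j) [True, False])"
  by (simp_all add: f_seq_def)

lemma f_odd_split: "f_seq (2 * j + 1) = f_seq (2 * j) + length ((tau ^^ j) [False])"
  using tau_pow_append[of j "[True]" "[False]"] by (simp add: f_even f_odd del: One_nat_def)

lemma f_rec:
  "f_seq 0 = 1" "f_seq 1 = 2"
  "f_seq (2 * j + 2) = f_seq (2 * j) + f_seq (2 * j + 1)"
  "f_seq (2 * j + 3) = f_seq (2 * j) + f_seq (2 * j + 2)"
proof -
  have e: "f_seq (2 * j + 2) = length ((tau ^^ Suc j) [True])" for j
    using f_even[of "Suc j"] by simp
  show "f_seq 0 = 1" "f_seq 1 = 2" by (simp_all add: f_seq_def)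
  show "f_seq (2 * j + 2) = f_seq (2 * j) + f_seq (2 * j + 1)"
    unfolding e tau_pow_1 f_odd_split by (simp add: f_even)
  have "f_seq (2 * j + 3) = f_seq (2 * j + 2) + length ((tau ^^ Suc j) [False])"
    using f_odd_split[of "Suc j"] by (simp add: numeral_3_eq_3)
  then show "f_seq (2 * j + 3) = f_seq (2 * j) + f_seq (2 * j + 2)"
    by (simp only: tau_pow_0 f_even)
qed

lemma f_pos: "0 < f_seq n"
proof -
  have "0 < f_seq (2 * j)" for j
    by (induction j) (use f_rec(1,3) in simp_all)
  then show ?thesis
    using f_odd_split[of "n div 2"] by (cases "even n") (force elim!: evenE oddE)+
qed

lemma even_f_odd: "even (f_seq (2 * j + 1))"
proof (induction j)
  case 0
  then show ?case using f_rec(2) by simp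
next
  case (Suc j)
  then show ?case using f_rec(3,4)[of j] by (simp add: numeral_3_eq_3)
qed

lemma tau_pow_length: "j < length ((tau ^^ j) [True])"
proof (induction j)
  case (Suc j)
  then show ?case
    using f_rec(3)[of j] f_pos[of "2 * j + 1"] f_even[of j] f_even[of "Suc j"]
    by simp
qed simp

lemma tau_pow_prefix:
  assumes "j \<le> k"
  shows "\<exists>w. (tau ^^ k) [True] = (tau ^^ j) [True] @ w"
  using assms
proof (induction k rule: dec_induct)
  case (step k)
  then show ?case by (metis tau_pow_1 append.assoc)
qed simp

lemma tau_pow_nth:
  assumes "i < length ((tau ^^ j) [True])"
  shows "(tau ^^ j) [True] ! i = s_letter i"
proof (cases "i \<le> j")
  case True
  then show ?thesis
    using tau_pow_prefix[OF True] tau_pow_length[of i] by (auto simp: s_letter_def nth_append)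
next
  case False
  then show ?thesis
    using tau_pow_prefix[of j i] assms by (auto simp: s_letter_def nth_append)
qed

lemma s_limit:
  "\<forall>\<^sub>F j in sequentially. i < length ((tau ^^ j) [True]) \<and> (tau ^^ j) [True] ! i = s_letter i"
proof -
  have "i < length ((tau ^^ j) [True])" if "i \<le> j" for j
    using tau_pow_length[of j] that by linarith
  then show ?thesis
    unfolding eventually_sequentially using tau_pow_nth by blast
qed

lemma s_take: "map s_letter [0..<length ((tau ^^ j) [True])] = (tau ^^ j) [True]"
  by (rule nth_equalityI) (simp_all add: tau_pow_nth)

lemma s_fixed_point:
  "tau (map s_letter [0..<n]) = map s_letter [0..<length (tau (map s_letter [0..<n]))]"
proof -
  let ?N = "length ((tau ^^ n) [True])"
  let ?p = "map s_letter [0..<n]" and ?q = "map s_letter [n..<?N]"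
  have "map s_letter [0..<?N] = ?p @ ?q"
    using tau_pow_length[of n] upt_add_eq_append[of 0 n "?N - n"]
    by (simp flip: map_append)
  then have "(tau ^^ n) [True] = ?p @ ?q"
    by (simp only: s_take)
  from arg_cong[OF this, of tau] have *: "(tau ^^ Suc n) [True] = tau ?p @ tau ?q"
    by simp
  have "tau ?p = take (length (tau ?p)) (map s_letter [0..<length ((tau ^^ Suc n) [True])])"
    unfolding s_take unfolding * by simp
  moreover have "length (tau ?p) \<le> length ((tau ^^ Suc n) [True])"
    unfolding * by simp
  ultimately show ?thesis
    by (simp add: take_map del: funpow.simps)
qed

end

theory Submission
  imports Defs
begin

text \<open>
  Put \<open>N = f (2 k + 3) = 2 q\<close> and \<open>h = f (2 k + 2)\<close>, so that \<open>h\<^sup>2 - 2 q\<^sup>2 = \<plusminus>1\<close>. The prefix of the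
  sequence that meets the Hankel matrix has period \<open>N\<close>, and it codes a rational rotation: the number
  of ones among the first \<open>y\<close> letters is \<open>(h y + b) div N\<close>, as the substitution sends a
  coding with slope \<open>h / N\<close> to one with slope \<open>(N + h) / (N + 2 h)\<close>. Up to reversing the rows,
  the Hankel matrix of order \<open>N - 1\<close> is therefore a principal minor of a circulant
  \<open>C = X ^ a (1 + X ^ r + ... + X ^ (r (h - 1)))\<close> of order \<open>N\<close>, where \<open>X\<close> is the cyclic shift
  and \<open>- r = h'\<close> is an inverse of \<open>h\<close> modulo \<open>N\<close>.
  Writing \<open>h h' = 1 + c N\<close> and \<open>J\<close> for the all-ones matrix, the circulant
  \<open>G = X ^ (-a) (1 + X ^ (-1) + ... + X ^ (1 - h'))\<close> satisfies \<open>C G = 1 + c J\<close>,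
  while \<open>det C = (-1) ^ a h\<close> because
  \<open>C (1 - X ^ r) = X ^ a (1 - X ^ (r h))\<close>. Hence \<open>adj C = (-1) ^ a (h G - c J)\<close>, and
  the minor is read off from the diagonal of \<open>h G - c J\<close>.
\<close>

section \<open>Minors of circulant matrices\<close>

text \<open>Transposition turns the column permutation into a second row permutation, and the two
  signs multiply to 1.\<close>

lemma det_permute_rows_cols:
  assumes A: "A \<in> carrier_mat n n" and p: "p permutes {0..<n}"
  shows "det (mat n n (\<lambda>(i, j). A $$ (p i, p j))) = det A"
proof -
  have pl: "p i < n" if "i < n" for i
    using permutes_in_image[OF p, of i] that by simp
  define B where "B = mat n n (\<lambda>(i, j). A $$ (p i, j))"
  have B: "B \<in> carrier_mat n n" by (simp add: B_def)
  have "det (mat n n (\<lambda>(i, j). A $$ (p i, p j)))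
      = det (mat n n (\<lambda>(i, j). B\<^sup>T $$ (p i, j)))"
    by (subst det_transpose[symmetric, of _ n])
       (auto intro!: arg_cong[of _ _ det] eq_matI simp: B_def pl)
  also have "\<dots> = signof p * det (B\<^sup>T)"
    using B by (intro det_permute_rows p) simp
  also have "\<dots> = signof p * (signof p * det A)"
    unfolding det_transpose[OF B] unfolding B_def by (simp add: det_permute_rows[OF A p])
  also have "\<dots> = det A"
    by (simp add: sign_def)
  finally show ?thesis .
qed

text \<open>Reversing rows is left multiplication by the antidiagonal matrix. The first column of
  that matrix has its only nonzero entry in the last row, so Laplace expansion gives the sign by
  induction.\<close>

lemma det_reverse_rows:
  fixes A :: "'a :: comm_ring_1 mat"
  assumes A: "A \<in> carrier_mat n n"
  shows "det (mat n n (\<lambda>(i, j). A $$ (n - 1 - i, j))) = (-1) ^ (n * (n - 1) div 2) * det A"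
proof -
  define J where "J n = mat n n (\<lambda>(i, j). of_bool (Suc (i + j) = n) :: 'a)" for n
  have J: "J n \<in> carrier_mat n n" for n by (simp add: J_def)
  have det_J: "det (J n) = (-1) ^ (n * (n - 1) div 2)" for n
  proof (induction n)
    case 0
    then show ?case by (simp add: det_def J_def)
  next
    case (Suc n)
    have "det (J (Suc n)) = (\<Sum>i<Suc n. J (Suc n) $$ (i, 0) * cofactor (J (Suc n)) i 0)"
      by (rule laplace_expansion_column[OF J]) simp
    also have "\<dots> = cofactor (J (Suc n)) n 0"
      by (subst sum.remove[of _ n]) (auto simp: J_def intro!: sum.neutral)
    also have "mat_delete (J (Suc n)) n 0 = J n"
      by (rule eq_matI) (auto simp: J_def mat_delete_def)
    then have "cofactor (J (Suc n)) n 0 = (-1) ^ n * det (J n)"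
      by (simp add: cofactor_def)
    also have "\<dots> = (-1) ^ (n + n * (n - 1) div 2)"
      by (simp add: Suc power_add)
    also have "n + n * (n - 1) div 2 = Suc n * (Suc n - 1) div 2"
      by (cases n) auto
    finally show ?case .
  qed
  have "mat n n (\<lambda>(i, j). A $$ (n - 1 - i, j)) = J n * A"
  proof (rule eq_matI)
    fix i j assume ij: "i < dim_row (J n * A)" "j < dim_col (J n * A)"
    then have *: "i < n" "j < n" using A by (auto simp: J_def)
    have "(J n * A) $$ (i, j) = (\<Sum>k = 0..<n. of_bool (Suc (i + k) = n) * A $$ (k, j))"
      using * A by (simp add: J_def scalar_prod_def)
    also have "\<dots> = A $$ (n - 1 - i, j)"
      using * by (subst sum.remove[of _ "n - 1 - i"]) (auto intro!: sum.neutral)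
    finally show "mat n n (\<lambda>(i, j). A $$ (n - 1 - i, j)) $$ (i, j) = (J n * A) $$ (i, j)"
      using * by simp
  qed (use A in \<open>auto simp: J_def\<close>)
  then show ?thesis
    by (simp add: det_mult[OF J A] det_J)
qed

section \<open>Circulants and cyclic convolution\<close>

text \<open>For an N-periodic \<open>c\<close> this is the sum of \<open>c e * X ^ e\<close> over
  residues e, with X the cyclic shift. Taking \<open>c\<close> on the integers avoids reducing
  negative differences modulo N.\<close>

definition circulant :: "nat \<Rightarrow> (int \<Rightarrow> 'a) \<Rightarrow> 'a mat" where
  "circulant N c = mat N N (\<lambda>(i, j). c (int j - int i))"

definition periodic :: "nat \<Rightarrow> (int \<Rightarrow> 'a) \<Rightarrow> bool" where
  "periodic N c \<longleftrightarrow> (\<forall>x. c (x + int N) = c x)"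

text \<open>The coefficient function of the identity; \<open>\<lambda>x. res_delta N (x - e)\<close>
  is that of the power \<open>X ^ e\<close>, with e allowed to be negative.\<close>

definition res_delta :: "nat \<Rightarrow> int \<Rightarrow> 'a :: comm_ring_1" where
  "res_delta N x = of_bool (int N dvd x)"

lemma circulant_carrier [simp]: "circulant N c \<in> carrier_mat N N"
  by (simp add: circulant_def)

lemma periodic_res_delta: "periodic N (\<lambda>x. res_delta N (x - e))"
  using dvd_add_triv_right_iff[of "int N" "x - e" for x]
  by (simp add: periodic_def res_delta_def diff_add_eq)

lemma periodic_sum:
  "(\<And>l. l \<in> L \<Longrightarrow> periodic N (c l)) \<Longrightarrow> periodic N (\<lambda>x. \<Sum>l\<in>L. c l x)"
  unfolding periodic_def by (auto intro!: sum.cong)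

lemma periodic_cmult: "periodic N c \<Longrightarrow> periodic N (\<lambda>x. t * c x)"
  by (simp add: periodic_def)

lemma periodic_add: "periodic N c \<Longrightarrow> periodic N d \<Longrightarrow> periodic N (\<lambda>x. c x + d x)"
  by (simp add: periodic_def)

lemma sum_periodic_shift:
  fixes F :: "int \<Rightarrow> 'a :: comm_ring_1"
  assumes "periodic N F"
  shows "(\<Sum>k<N. F (int k + int i)) = (\<Sum>k<N. F (int k))"
proof (induction i)
  case (Suc i)
  have "(\<Sum>k<N. F (int k + int (Suc i))) + F (int i) = (\<Sum>k<N. F (int (Suc k) + int i)) + F (int 0 + int i)"
    by (simp add: algebra_simps)
  also have "\<dots> = (\<Sum>k<Suc N. F (int k + int i))"
    by (subst sum.lessThan_Suc_shift) (simp add: algebra_simps)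
  also have "\<dots> = (\<Sum>k<N. F (int k + int i)) + F (int i)"
    using assms[unfolded periodic_def, rule_format, of "int i"] by (simp add: add.commute)
  finally show ?case using Suc by simp
qed simp

lemma circulant_mult:
  fixes c d :: "int \<Rightarrow> 'a :: comm_ring_1"
  assumes "periodic N c" "periodic N d"
  shows "circulant N c * circulant N d = circulant N (\<lambda>x. \<Sum>k<N. c (int k) * d (x - int k))"
proof (rule eq_matI)
  fix i j
  assume "i < dim_row (circulant N (\<lambda>x. \<Sum>k<N. c (int k) * d (x - int k)))"
    and "j < dim_col (circulant N (\<lambda>x. \<Sum>k<N. c (int k) * d (x - int k)))"
  then have ij: "i < N" "j < N" by (auto simp: circulant_def)
  \<comment> \<open>The matrix product sums over a full period beginning at -i in the argument of
    \<open>c\<close>; periodicity of the summand moves the window to begin at 0.\<close>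
  define F where "F y = c (y - int i) * d (int j - y)" for y
  have "periodic N F"
  proof -
    have "d (int j - (y + int N)) = d (int j - y)" for y
      using assms(2)[unfolded periodic_def, rule_format, of "int j - (y + int N)"] by simp
    moreover have "c (y + int N - int i) = c (y - int i)" for y
      using assms(1)[unfolded periodic_def, rule_format, of "y - int i"] by (simp add: algebra_simps)
    ultimately show ?thesis by (simp add: periodic_def F_def)
  qed
  then have "(\<Sum>k<N. F (int k + int i)) = (\<Sum>k<N. F (int k))"
    by (rule sum_periodic_shift)
  then show "(circulant N c * circulant N d) $$ (i, j)
      = circulant N (\<lambda>x. \<Sum>k<N. c (int k) * d (x - int k)) $$ (i, j)"
    using ij by (simp add: circulant_def scalar_prod_def F_def atLeast0LessThan algebra_simps)
qed (auto simp: circulant_def)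

lemma sum_res_delta:
  fixes c :: "int \<Rightarrow> 'a :: comm_ring_1"
  assumes "N > 0" "periodic N c"
  shows "(\<Sum>k<N. c (int k) * res_delta N (x - int k)) = c x"
proof -
  define k0 where "k0 = nat (x mod int N)"
  have k0: "int k0 = x mod int N" using assms(1) by (simp add: k0_def)
  have per: "c (y + int N * z) = c y" if "z \<ge> 0" for y z
    using that
  proof (induction z rule: int_ge_induct)
    case (step z)
    have "c (y + int N * z + int N) = c (y + int N * z)"
      using assms(2) by (simp add: periodic_def)
    with step show ?case by (simp add: algebra_simps)
  qed simp
  have "c x = c (x mod int N)"
  proof (cases "x div int N \<ge> 0")
    case True
    from per[OF this, of "x mod int N"] show ?thesis by simp
  next
    case False
    then have "- (x div int N) \<ge> 0" by simp
    from per[OF this, of x] show ?thesis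
      by (metis minus_mult_div_eq_mod mult_minus_right uminus_add_conv_diff add.commute)
  qed
  moreover have "res_delta N (x - int k) = (of_bool (k = k0) :: 'a)" if "k < N" for k
  proof -
    have "int N dvd x - int k \<longleftrightarrow> x mod int N = int k mod int N"
      by (simp add: mod_eq_dvd_iff)
    also have "\<dots> \<longleftrightarrow> k = k0" using that k0 by auto
    finally show ?thesis by (simp add: res_delta_def)
  qed
  moreover have "k0 < N" using assms(1) by (simp add: k0_def nat_less_iff)
  ultimately show ?thesis
    by (simp add: k0 of_bool_def if_distrib[of "(*) _"] cong: if_cong)
qed

section \<open>Determinants of two-term circulants and of progressions\<close>

text \<open>The first column has only the entries \<alpha> in row 0 and \<beta> in row N - 1, and
  both complementary minors are triangular. The minus sign is \<open>(-1) ^ (N - 1)\<close> for even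
  N.\<close>

lemma det_circulant_binomial_1:
  fixes \<alpha> \<beta> :: "'a :: comm_ring_1"
  assumes "N \<ge> 2" "even N"
  shows "det (circulant N (\<lambda>x. \<alpha> * res_delta N x + \<beta> * res_delta N (x - 1))) = \<alpha> ^ N - \<beta> ^ N"
proof -
  define A where "A = circulant N (\<lambda>x. \<alpha> * res_delta N x + \<beta> * res_delta N (x - 1))"
  have A: "A \<in> carrier_mat N N" by (simp add: A_def)
  \<comment> \<open>The lower endpoint is included because j - i - 1 reaches -N at the wrap-around
    corner i = N - 1, j = 0.\<close>
  have dvd_iff: "int N dvd x \<longleftrightarrow> x = 0 \<or> x = - int N" if "- int N \<le> x" "x < int N" for x
  proof
    assume "int N dvd x"
    then obtain k where k: "x = int N * k" ..
    have "int N * (-1) \<le> int N * k" "int N * k < int N * 1"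
      using that k by simp_all
    then have "-1 \<le> k" "k < 1"
      using assms(1) by (simp_all only: mult_le_cancel_left_pos mult_less_cancel_left_pos of_nat_0_less_iff)
    then have "k = 0 \<or> k = -1" by linarith
    then show "x = 0 \<or> x = - int N" using k by auto
  qed auto
  have ent: "A $$ (i, j) = (if i = j then \<alpha> else 0) + (if j = Suc i \<or> (i = N - 1 \<and> j = 0) then \<beta> else 0)"
    if "i < N" "j < N" for i j
  proof -
    have "int N dvd int j - int i \<longleftrightarrow> i = j"
      using that by (subst dvd_iff) auto
    moreover have "int N dvd int j - int i - 1 \<longleftrightarrow> j = Suc i \<or> (i = N - 1 \<and> j = 0)"
      using that by (subst dvd_iff) auto
    ultimately show ?thesis
      using that assms(1) by (auto simp: A_def circulant_def res_delta_def)
  qed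
  have "det A = (\<Sum>i<N. A $$ (i, 0) * cofactor A i 0)"
    by (rule laplace_expansion_column[OF A]) (use assms in simp)
  also have "\<dots> = (\<Sum>i\<in>{0, N - 1}. A $$ (i, 0) * cofactor A i 0)"
    by (rule sum.mono_neutral_right) (use assms in \<open>auto simp: ent\<close>)
  also have "\<dots> = \<alpha> * cofactor A 0 0 + \<beta> * cofactor A (N - 1) 0"
    using assms by (simp add: ent)
  also have "cofactor A 0 0 = \<alpha> ^ (N - 1)"
  proof -
    have "det (mat_delete A 0 0) = prod_list (diag_mat (mat_delete A 0 0))"
      by (rule det_upper_triangular[where n = "N - 1"])
         (use A in \<open>auto simp: mat_delete_def ent\<close>)
    also have "diag_mat (mat_delete A 0 0) = replicate (N - 1) \<alpha>"
      using A by (intro nth_equalityI) (auto simp: diag_mat_def mat_delete_def ent)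
    finally show ?thesis by (simp add: cofactor_def)
  qed
  also have "cofactor A (N - 1) 0 = - (\<beta> ^ (N - 1))"
  proof -
    have "det (mat_delete A (N - 1) 0) = prod_list (diag_mat (mat_delete A (N - 1) 0))"
      by (rule det_lower_triangular[where n = "N - 1"])
         (use A in \<open>auto simp: mat_delete_def ent\<close>)
    also have "diag_mat (mat_delete A (N - 1) 0) = replicate (N - 1) \<beta>"
      using A by (intro nth_equalityI) (auto simp: diag_mat_def mat_delete_def ent)
    finally show ?thesis using assms by (simp add: cofactor_def)
  qed
  also have "\<alpha> * \<alpha> ^ (N - 1) + \<beta> * - (\<beta> ^ (N - 1)) = \<alpha> ^ N - \<beta> ^ N"
    using assms(1) by (cases N) auto
  finally show ?thesis by (simp add: A_def)
qed

text \<open>As e is a unit modulo N, multiplication by e permutes the residues. Relabelling rows and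
  columns by it turns step e into step 1.\<close>

lemma det_circulant_binomial:
  fixes \<alpha> \<beta> :: "'a :: comm_ring_1"
  assumes "N \<ge> 2" "even N" and e: "coprime e (int N)"
  shows "det (circulant N (\<lambda>x. \<alpha> * res_delta N x + \<beta> * res_delta N (x - e))) = \<alpha> ^ N - \<beta> ^ N"
proof -
  define A where "A = circulant N (\<lambda>x. \<alpha> * res_delta N x + \<beta> * res_delta N (x - e))"
  \<comment> \<open>\<open>permutes\<close> demands the identity outside the index range.\<close>
  define p where "p i = (if i < N then nat (e * int i mod int N) else i)" for i
  have N: "N > 0" using assms by simp
  have p_less: "p i < N" if "i < N" for i
    using that N by (simp add: p_def nat_less_iff)
  have int_p: "int (p i) = e * int i mod int N" if "i < N" for i
    using that N by (simp add: p_def)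
  have p_cong: "int N dvd int (p j) - int (p i) - e * x \<longleftrightarrow> int N dvd int j - int i - x" if "i < N" "j < N" for i j x
  proof -
    have dp: "int N dvd int (p i) - e * int i" if "i < N" for i
      by (simp add: int_p[OF that] flip: mod_eq_dvd_iff)
    have "int N dvd (int (p j) - e * int j) - (int (p i) - e * int i)"
      using that by (intro dvd_diff dp)
    from dvd_add_right_iff[OF this, of "e * (int j - int i - x)"]
    have "int N dvd int (p j) - int (p i) - e * x \<longleftrightarrow> int N dvd e * (int j - int i - x)"
      by (simp add: algebra_simps)
    also have "\<dots> \<longleftrightarrow> int N dvd int j - int i - x"
      using e by (simp add: coprime_commute coprime_dvd_mult_right_iff)
    finally show ?thesis .
  qed
  have "inj_on p {0..<N}"
  proof (rule inj_onI)
    fix i j assume ij: "i \<in> {0..<N}" "j \<in> {0..<N}" "p i = p j"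
    then have "int N dvd int j - int i" using p_cong[of i j 0] by simp
    then have "int j mod int N = int i mod int N" by (simp add: mod_eq_dvd_iff)
    with ij show "i = j" by simp
  qed
  moreover from this have "p ` {0..<N} = {0..<N}"
    by (intro endo_inj_surj) (auto intro: p_less)
  ultimately have "bij_betw p {0..<N} {0..<N}"
    by (simp add: bij_betw_def)
  then have p: "p permutes {0..<N}"
    by (rule bij_imp_permutes) (simp add: p_def)
  have "det A = det (mat N N (\<lambda>(i, j). A $$ (p i, p j)))"
    by (rule det_permute_rows_cols[symmetric, OF _ p]) (simp add: A_def)
  also have "mat N N (\<lambda>(i, j). A $$ (p i, p j))
      = circulant N (\<lambda>x. \<alpha> * res_delta N x + \<beta> * res_delta N (x - 1))"
    using p_cong[of _ _ 0] p_cong[of _ _ 1]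
    by (intro eq_matI) (auto simp: A_def circulant_def res_delta_def p_less)
  finally show ?thesis
    using det_circulant_binomial_1[OF assms(1,2), of \<alpha> \<beta>] by (simp add: A_def)
qed

lemma circulant_mult_binomial:
  fixes c :: "int \<Rightarrow> 'a :: comm_ring_1"
  assumes "N > 0" "periodic N c"
  shows "circulant N c * circulant N (\<lambda>x. \<alpha> * res_delta N x + \<beta> * res_delta N (x - e))
       = circulant N (\<lambda>x. \<alpha> * c x + \<beta> * c (x - e))"
proof -
  have "(\<Sum>k<N. c (int k) * (\<alpha> * res_delta N (x - int k) + \<beta> * res_delta N (x - int k - e)))
      = \<alpha> * c x + \<beta> * c (x - e)" for x
  proof -
    have "(\<Sum>k<N. c (int k) * (\<alpha> * res_delta N (x - int k) + \<beta> * res_delta N (x - int k - e)))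
      = \<alpha> * (\<Sum>k<N. c (int k) * res_delta N (x - int k))
        + \<beta> * (\<Sum>k<N. c (int k) * res_delta N (x - e - int k))"
      by (simp add: sum_distrib_left sum.distrib[symmetric] algebra_simps)
    then show ?thesis by (simp only: sum_res_delta[OF assms])
  qed
  moreover have "periodic N (\<lambda>x. \<alpha> * res_delta N x + \<beta> * res_delta N (x - e))"
    using periodic_res_delta[of N 0] periodic_res_delta[of N e]
    by (intro periodic_add periodic_cmult) simp_all
  ultimately show ?thesis
    by (simp add: circulant_mult[OF assms(2)])
qed

lemma det_circulant_shift:
  assumes "N \<ge> 2" "even N"
  shows "det (circulant N (\<lambda>x. res_delta N (x - int a))) = (-1 :: 'a :: comm_ring_1) ^ a"
proof (induction a)
  case 0
  show ?case using det_circulant_binomial_1[OF assms, of 1 "0 :: 'a"] assms by (simp add: power_0_left)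
next
  case (Suc a)
  let ?E = "\<lambda>e. circulant N (\<lambda>x. res_delta N (x - e)) :: 'a mat"
  have "det (?E 1) = -1"
    using det_circulant_binomial_1[OF assms, of 0 "1 :: 'a"] assms by (simp add: power_0_left)
  moreover have "?E (int (Suc a)) = ?E (int a) * ?E 1"
    \<comment> \<open>The shift X is the binomial with \<alpha> = 0 and \<beta> = 1; its determinant
      is -1 because N is even.\<close>
    using circulant_mult_binomial[of N "\<lambda>x. res_delta N (x - int a)" 0 "1 :: 'a" 1] assms(1)
    by (simp add: periodic_res_delta algebra_simps)
  ultimately show ?case
    using Suc by (simp add: det_mult[of _ N])
qed

lemma res_delta_add_multiple: "res_delta N (x + z * int N) = res_delta N x"
  by (simp add: res_delta_def)

text \<open>With formal weights \<open>t ^ l\<close> both factors \<open>1 - t X ^ (-h')\<close> and \<open>1 - t ^ h X ^ (-h h')\<close> of the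
  telescoping identity are nonsingular, which they are not at \<open>t = 1\<close>; the specialisation to
  \<open>t = 1\<close> is made only after cancelling \<open>1 - t ^ N\<close>, and this fixes the sign of the determinant.\<close>

lemma det_circulant_progression_times:
  fixes t :: "'a :: comm_ring_1"
  assumes N: "N \<ge> 2" "even N" and inv: "int h * int h' = 1 + int q * int N"
  shows "det (circulant N (\<lambda>x. \<Sum>l<h. t ^ l * res_delta N (x - int a + int h' * int l))) * (1 - t ^ N)
       = (-1) ^ a * (1 - (t ^ N) ^ h)"
proof -
  define d where "d l x = (t ^ l * res_delta N (x - int a + int h' * int l) :: 'a)" for l x
  define c where "c x = (\<Sum>l<h. d l x)" for x
  let ?B = "\<lambda>\<beta> e. circulant N (\<lambda>x. 1 * res_delta N x + \<beta> * res_delta N (x - e)) :: 'a mat"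
  let ?E = "circulant N (\<lambda>x. res_delta N (x - int a)) :: 'a mat"
  have per_d: "periodic N (d l)" for l
    using periodic_cmult[OF periodic_res_delta[of N "int a - int h' * int l"], of "t ^ l"]
    by (simp add: d_def[abs_def] algebra_simps)
  have per: "periodic N c"
    unfolding c_def[abs_def] by (rule periodic_sum) (rule per_d)
  have "1 * c x + (- t) * c (x - (- int h')) = 1 * res_delta N (x - int a) + (- (t ^ h)) * res_delta N (x - (-1) - int a)" for x
  proof -
    have "1 * c x + (- t) * c (x - (- int h')) = (\<Sum>l<h. d l x - d (Suc l) x)"
      by (simp add: c_def d_def sum_distrib_left sum_subtractf sum_negf algebra_simps)
    also have "\<dots> = d 0 x - d h x"
      by (rule sum_lessThan_telescope')
    \<comment> \<open>Since h h' is 1 modulo N, the far end of the telescope is displaced by one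
      step only, up to whole periods.\<close>
    also have "d h x = t ^ h * res_delta N (x - (-1) - int a + int q * int N)"
      using inv by (simp add: d_def algebra_simps)
    finally show ?thesis by (simp add: d_def res_delta_add_multiple)
  qed
  moreover have "N > 0" using N by simp
  ultimately have "circulant N c * ?B (- t) (- int h') = ?E * ?B (- (t ^ h)) (-1)"
    by (simp only: circulant_mult_binomial[OF _ per] circulant_mult_binomial[OF _ periodic_res_delta])
  then have "det (circulant N c) * det (?B (- t) (- int h')) = det ?E * det (?B (- (t ^ h)) (-1))"
    by (simp only: det_mult[OF circulant_carrier circulant_carrier, symmetric])
  moreover have "coprime (- int h') (int N)"
  proof -
    have "coprime (int h') (int N)"
    proof (rule coprimeI)
      fix u assume "u dvd int h'" "u dvd int N"
      then have "u dvd int h * int h' - int q * int N" by (intro dvd_diff dvd_mult)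
      then show "u dvd 1" by (simp add: inv)
    qed
    then show ?thesis by simp
  qed
  moreover have "(- (t ^ h)) ^ N = (t ^ N) ^ h" "(- t) ^ N = t ^ N"
    using N(2) by (simp_all flip: power_mult add: mult.commute)
  moreover have "coprime (-1) (int N)" by simp
  ultimately have "det (circulant N c) * (1 - t ^ N) = (-1) ^ a * (1 - (t ^ N) ^ h)"
    by (simp only: det_circulant_binomial[OF N] det_circulant_shift[OF N] power_one)
  then show ?thesis by (simp add: c_def[abs_def] d_def)
qed

lemma det_circulant_progression:
  assumes N: "N \<ge> 2" "even N" and inv: "int h * int h' = 1 + int q * int N"
  shows "det (circulant N (\<lambda>x. \<Sum>l<h. res_delta N (x - int a + int h' * int l))) = (-1) ^ a * int h"
proof -
  \<comment> \<open>With t the indeterminate over the integers, \<open>1 - t ^ N\<close> is a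
    nonzero element of an integral domain and can be cancelled. The remaining geometric sum takes
    the value h at 1.\<close>
  define t where "t = [:0, 1 :: int:]"
  define C where "C = circulant N (\<lambda>x. \<Sum>l<h. t ^ l * res_delta N (x - int a + int h' * int l))"
  have "det C * (1 - t ^ N) = (-1) ^ a * (1 - (t ^ N) ^ h)"
    unfolding C_def by (rule det_circulant_progression_times[OF N inv])
  also have "1 - (t ^ N) ^ h = (1 - t ^ N) * (\<Sum>i<h. (t ^ N) ^ i)"
    by (rule one_diff_power_eq)
  finally have "(1 - t ^ N) * det C = (1 - t ^ N) * ((-1) ^ a * (\<Sum>i<h. (t ^ N) ^ i))"
    by (simp add: mult_ac)
  moreover have "poly (1 - t ^ N) 0 \<noteq> 0"
    using N by (simp add: t_def power_0_left)
  then have "1 - t ^ N \<noteq> 0" by fastforce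
  ultimately have "det C = (-1) ^ a * (\<Sum>i<h. (t ^ N) ^ i)"
    by simp
  then have "poly (det C) 1 = (-1) ^ a * int h"
    by (simp add: t_def poly_sum)
  also have "poly (det C) 1 = det (map_mat (\<lambda>p. poly p 1) C)"
  proof -
    interpret eval1: comm_ring_hom "\<lambda>p. poly p (1 :: int)"
      by unfold_locales auto
    show ?thesis by (rule eval1.hom_det[symmetric])
  qed
  also have "map_mat (\<lambda>p. poly p 1) C = circulant N (\<lambda>x. \<Sum>l<h. res_delta N (x - int a + int h' * int l))"
    by (rule eq_matI) (auto simp: C_def circulant_def t_def poly_sum res_delta_def intro!: sum.cong)
  finally show ?thesis .
qed

section \<open>The principal minor of a progression circulant\<close>

lemma sum_res_delta_period:
  assumes "N > 0"
  shows "(\<Sum>k<N. res_delta N (y + int k)) = (1 :: 'a :: comm_ring_1)"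
proof -
  have "res_delta N (y + int k) = (1 * res_delta N (- y - int k) :: 'a)" for k
    using dvd_minus_iff[of "int N" "y + int k"] by (simp add: res_delta_def)
  then show ?thesis
    using sum_res_delta[OF assms, of "\<lambda>_. 1 :: 'a" "- y"] by (simp add: periodic_def)
qed

lemma sum_blocks:
  fixes f :: "nat \<Rightarrow> 'a :: comm_monoid_add"
  shows "(\<Sum>m<n. \<Sum>i<k. f (m * k + i)) = (\<Sum>u<n * k. f u)"
proof -
  have "(\<Sum>i<k. f (m * k + i)) = sum f {m * k..<m * k + k}" for m
    using sum.shift_bounds_nat_ivl[of f 0 "m * k" k]
    by (simp only: atLeast0LessThan add.commute[of _ "m * k"] add_0_right)
  then show ?thesis by (simp only: sum.nat_group)
qed

text \<open>Here \<open>g\<close> is the coefficient function of G in the overview, and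
  \<open>q\<close> is the c there. The matrix B = h G - q J satisfies C B = h 1, which identifies
  the adjugate; its last diagonal entry is the minor.\<close>

lemma det_circulant_progression_minor:
  assumes N: "N \<ge> 2" "even N" and inv: "int h * int h' = 1 + int q * int N"
  shows "det (mat (N - 1) (N - 1) (\<lambda>(i, j). \<Sum>l<h. res_delta N (int j - int i - int a + int h' * int l)))
       = (-1) ^ a * (int h * (\<Sum>i<h'. res_delta N (int a + int i)) - int q)"
proof -
  have N0: "N > 0" using N by simp
  define c where "c x = (\<Sum>l<h. res_delta N (x - int a + int h' * int l) :: int)" for x
  define g where "g x = (\<Sum>i<h'. res_delta N (x + int a + int i) :: int)" for x
  define b where "b x = int h * g x - int q" for x
  define C where "C = circulant N c"
  define B where "B = circulant N b"
  have C: "C \<in> carrier_mat N N" and B: "B \<in> carrier_mat N N" by (simp_all add: C_def B_def)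
  have per_c: "periodic N c"
    unfolding c_def[abs_def] using periodic_res_delta[of N "int a - int h' * int l" for l]
    by (intro periodic_sum) (simp add: algebra_simps)
  have per_g: "periodic N g"
    unfolding g_def[abs_def] using periodic_res_delta[of N "- int a - int i" for i]
    by (intro periodic_sum) (simp add: algebra_simps)
  have per_b: "periodic N b"
    using per_g by (simp add: b_def periodic_def)
  have sum_c: "(\<Sum>k<N. c (int k)) = int h"
  proof -
    have "(\<Sum>k<N. c (int k)) = (\<Sum>l<h. \<Sum>k<N. res_delta N ((int h' * int l - int a) + int k))"
      unfolding c_def by (subst sum.swap) (simp add: algebra_simps)
    then show ?thesis by (simp only: sum_res_delta_period[OF N0]) simp
  qed
  have hh': "h * h' = Suc (q * N)"
  proof -
    have "int (h * h') = int (Suc (q * N))" using inv by simp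
    then show ?thesis by (simp only: of_nat_eq_iff)
  qed
  \<comment> \<open>The pairs (l, i) enumerate u = l h' + i below h h' = q N + 1. The q full periods
    contribute 1 each, and the one leftover term is the delta.\<close>
  have conv_g: "(\<Sum>k<N. c (int k) * g (x - int k)) = res_delta N x + int q" for x
  proof -
    have "(\<Sum>k<N. c (int k) * g (x - int k))
        = (\<Sum>i<h'. \<Sum>k<N. c (int k) * res_delta N ((x + int a + int i) - int k))"
      unfolding g_def sum_distrib_left by (subst sum.swap) (simp add: algebra_simps)
    also have "\<dots> = (\<Sum>i<h'. c (x + int a + int i))"
      by (simp only: sum_res_delta[OF N0 per_c])
    also have "\<dots> = (\<Sum>l<h. \<Sum>i<h'. res_delta N (x + int (l * h' + i)))"
      unfolding c_def by (subst sum.swap) (simp add: algebra_simps)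
    also have "\<dots> = (\<Sum>u<h * h'. res_delta N (x + int u))"
      by (rule sum_blocks)
    also note hh'
    also have "(\<Sum>u<Suc (q * N). res_delta N (x + int u) :: int)
        = (\<Sum>m<q. \<Sum>i<N. res_delta N ((x + int m * int N) + int i)) + res_delta N (x + int q * int N)"
      using sum_blocks[of "\<lambda>u. res_delta N (x + int u) :: int" N q, symmetric] by (simp add: algebra_simps)
    finally show ?thesis
      by (simp add: sum_res_delta_period[OF N0] res_delta_add_multiple)
  qed
  have "(\<Sum>k<N. c (int k) * b (x - int k)) = int h * res_delta N x" for x
  proof -
    have "(\<Sum>k<N. c (int k) * b (x - int k))
        = int h * (\<Sum>k<N. c (int k) * g (x - int k)) - int q * (\<Sum>k<N. c (int k))"
      by (simp add: b_def sum_distrib_left sum_subtractf[symmetric] algebra_simps)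
    also have "\<dots> = int h * res_delta N x"
      by (simp only: conv_g sum_c) (simp add: algebra_simps)
    finally show ?thesis .
  qed
  then have "C * B = circulant N (\<lambda>x. int h * res_delta N x)"
    by (simp add: C_def B_def circulant_mult[OF per_c per_b])
  also have "\<dots> = int h \<cdot>\<^sub>m 1\<^sub>m N"
  proof (rule eq_matI)
    fix i j assume "i < dim_row (int h \<cdot>\<^sub>m 1\<^sub>m N)" "j < dim_col (int h \<cdot>\<^sub>m 1\<^sub>m N)"
    then have "i < N" "j < N" by simp_all
    moreover from this have "int N dvd int j - int i \<longleftrightarrow> i = j"
      by (auto simp flip: mod_eq_dvd_iff)
    ultimately show "circulant N (\<lambda>x. int h * res_delta N x) $$ (i, j) = (int h \<cdot>\<^sub>m 1\<^sub>m N) $$ (i, j)"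
      by (simp add: circulant_def res_delta_def)
  qed (simp_all add: circulant_def)
  finally have CB: "C * B = int h \<cdot>\<^sub>m 1\<^sub>m N" .
  \<comment> \<open>Multiplying C B = h 1 on the left by the adjugate gives h adj C = det C B. As
    det C is h up to sign and h is nonzero, h cancels.\<close>
  note adj = adj_mat[OF C]
  have "int h \<cdot>\<^sub>m adj_mat C = adj_mat C * (C * B)"
    unfolding CB mult_smult_distrib[OF adj(1) one_carrier_mat] right_mult_one_mat[OF adj(1)] ..
  also have "\<dots> = (adj_mat C * C) * B"
    by (rule assoc_mult_mat[OF adj(1) C B, symmetric])
  also have "\<dots> = det C \<cdot>\<^sub>m B"
    unfolding adj(3) mult_smult_assoc_mat[OF one_carrier_mat B] left_mult_one_mat[OF B] ..
  finally have "(int h \<cdot>\<^sub>m adj_mat C) $$ (N - 1, N - 1) = (det C \<cdot>\<^sub>m B) $$ (N - 1, N - 1)"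
    by simp
  then have "int h * cofactor C (N - 1) (N - 1) = det C * b 0"
    using N0 C B by (simp add: adj_mat_def B_def circulant_def)
  moreover have "det C = (-1) ^ a * int h"
    unfolding C_def c_def[abs_def] by (rule det_circulant_progression[OF N inv])
  moreover have "h \<noteq> 0" using hh' by (intro notI) simp
  ultimately have "cofactor C (N - 1) (N - 1) = (-1) ^ a * b 0"
    by simp
  moreover have "mat_delete C (N - 1) (N - 1) = mat (N - 1) (N - 1) (\<lambda>(i, j). c (int j - int i))"
    by (rule eq_matI) (use C in \<open>auto simp: mat_delete_def C_def circulant_def\<close>)
  ultimately show ?thesis
    by (simp add: cofactor_def c_def b_def g_def)
qed

section \<open>The sequence as a coding of a rational rotation\<close>

definition ones :: "nat \<Rightarrow> nat" where
  "ones n = (\<Sum>i<n. of_bool (s_letter i))"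

lemma ones_0 [simp]: "ones 0 = 0"
  and ones_Suc [simp]: "ones (Suc n) = ones n + of_bool (s_letter n)"
  by (simp_all add: ones_def)

text \<open>A one expands to three letters and a zero to one, so the image of letter n starts at
  position \<open>n + 2 * ones n\<close>.\<close>

lemma length_tau_prefix: "length (tau (map s_letter [0..<n])) = n + 2 * ones n"
proof (induction n)
  case (Suc n)
  then show ?case by (cases "s_letter n") simp_all
qed simp

lemma s_letter_tau_block:
  assumes "i < length (tau_letter (s_letter n))"
  shows "s_letter (n + 2 * ones n + i) = tau_letter (s_letter n) ! i"
proof -
  let ?u = "tau (map s_letter [0..<n])"
  have "?u @ tau_letter (s_letter n) = tau (map s_letter [0..<Suc n])"
    by simp
  also have "\<dots> = map s_letter [0..<length (tau (map s_letter [0..<Suc n]))]"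
    by (rule s_fixed_point)
  also have "length (tau (map s_letter [0..<Suc n])) = length ?u + length (tau_letter (s_letter n))"
    by simp
  finally have "(?u @ tau_letter (s_letter n)) ! (length ?u + i)
      = map s_letter [0..<length ?u + length (tau_letter (s_letter n))] ! (length ?u + i)"
    by (rule arg_cong)
  then show ?thesis
    using assms by (simp add: nth_append length_tau_prefix)
qed

lemma s_letter_block_start: "s_letter (n + 2 * ones n)"
  using s_letter_tau_block[of 0 n] by (cases "s_letter n") simp_all

lemma s_letter_block_of_one:
  assumes "s_letter n"
  shows "\<not> s_letter (n + 2 * ones n + 1)" "s_letter (n + 2 * ones n + 2)"
  using s_letter_tau_block[of 1 n] s_letter_tau_block[of 2 n] assms by simp_all

text \<open>Every block contains one letter 1, and the block of a one contains a second.\<close>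

lemma ones_block_start: "ones (n + 2 * ones n) = n + ones n"
proof (induction n)
  case (Suc n)
  show ?case
  proof (cases "s_letter n")
    case True
    have "Suc n + 2 * ones (Suc n) = Suc (Suc (Suc (n + 2 * ones n)))"
      using True by simp
    then show ?thesis
      using Suc s_letter_block_start[of n] s_letter_block_of_one[OF True] True by simp
  next
    case False
    then show ?thesis using Suc s_letter_block_start[of n] by simp
  qed
qed simp

text \<open>Division-free form of \<open>ones y = (h * y + b) div N\<close> for all \<open>y \<le> L\<close>.\<close>

definition coded_upto :: "int \<Rightarrow> int \<Rightarrow> int \<Rightarrow> nat \<Rightarrow> bool" where
  "coded_upto N h b L \<longleftrightarrow>
     (\<forall>y\<le>L. N * int (ones y) \<le> h * int y + b \<and> h * int y + b < N * int (ones y) + N)"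

text \<open>The new intercept \<open>N + h - 1 - b\<close> is the only one for which the blocks \<open>tau_letter True\<close> are
  coded correctly.\<close>

lemma coded_upto_step:
  assumes "N > 0" "0 \<le> h" "h \<le> N" and coded: "coded_upto N h b L"
  shows "coded_upto (N + 2 * h) (N + h) (N + h - 1 - b) (L + 2 * ones L + 1)"
proof -
  define G where "G y \<longleftrightarrow> (N + 2 * h) * int (ones y) \<le> (N + h) * int y + (N + h - 1 - b) \<and>
     (N + h) * int y + (N + h - 1 - b) < (N + 2 * h) * int (ones y) + (N + 2 * h)" for y
  have bounds: "N * int (ones y) \<le> h * int y + b" "h * int y + b < N * int (ones y) + N" if "y \<le> L" for y
    using coded that by (auto simp: coded_upto_def)
  have ones_1: "ones (n + 2 * ones n + 1) = n + ones n + 1" for n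
    using s_letter_block_start[of n] by (simp add: ones_block_start)
  have G0: "G (n + 2 * ones n)" and G1: "G (n + 2 * ones n + 1)" if "n \<le> L" for n
    unfolding G_def ones_block_start ones_1
    using bounds[OF that] assms(1-3) by (simp_all add: algebra_simps)
  \<comment> \<open>After the prefix 10 of a block 101, the upper bound is the old lower bound at
    \<open>Suc n\<close>. This is where \<open>Suc n\<close> must lie in the old range, so of block
    L only the first letter is covered.\<close>
  have G2: "G (n + 2 * ones n + 2)" if "Suc n \<le> L" "s_letter n" for n
  proof -
    have "ones (n + 2 * ones n + 2) = n + ones n + 1"
      using s_letter_block_start[of n] s_letter_block_of_one[OF that(2)] by (simp add: ones_block_start)
    then show ?thesis
      unfolding G_def
      using bounds[of n] bounds[OF that(1)] that assms(1-3)
      by (simp add: algebra_simps)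
  qed
  have "\<forall>y\<le>n + 2 * ones n + 1. G y" if "n \<le> L" for n
    using that
  proof (induction n)
    case 0
    then show ?case using G0[of 0] G1[of 0] by (auto simp: le_Suc_eq)
  next
    case (Suc n)
    then have IH: "\<forall>y\<le>n + 2 * ones n + 1. G y" by simp
    show ?case
    proof (cases "s_letter n")
      case True
      then show ?thesis
        using IH G0[OF Suc.prems] G1[OF Suc.prems] G2[OF Suc.prems True] by (auto simp: le_Suc_eq)
    next
      case False
      then show ?thesis
        using IH G1[OF Suc.prems] by (auto simp: le_Suc_eq)
    qed
  qed
  from this[of L] show ?thesis by (simp add: coded_upto_def G_def)
qed

text \<open>With \<rho> the position on the circle, the letter is 1 iff the step by h crosses a
  multiple of N, that is, iff N lies among \<rho> + 1, ..., \<rho> + h. The sum then has a single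
  nonzero term. Detecting the crossing uses the coding at \<open>Suc y\<close>, hence y < L.\<close>

lemma s_letter_coded:
  assumes "0 \<le> h" "h \<le> int N" and coded: "coded_upto (int N) h b L" and "y < L"
  shows "of_bool (s_letter y) = (\<Sum>l<nat h. res_delta N (h * int y + b + 1 + int l) :: int)"
proof -
  define \<rho> where "\<rho> = h * int y + b - int N * int (ones y)"
  have \<rho>: "0 \<le> \<rho>" "\<rho> < int N"
    using coded[unfolded coded_upto_def, rule_format, of y] assms(4) unfolding \<rho>_def by linarith+
  have "\<rho> + h \<ge> int N \<longleftrightarrow> s_letter y"
    using coded[unfolded coded_upto_def, rule_format, of "Suc y"] assms(1,2,4)
    by (cases "s_letter y") (simp_all add: \<rho>_def algebra_simps)
  moreover have "res_delta N (h * int y + b + 1 + int l) = (of_bool (int l = int N - 1 - \<rho>) :: int)"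
    if "l < nat h" for l
  proof -
    have "h * int y + b + 1 + int l = (\<rho> + 1 + int l) + int (ones y) * int N"
      by (simp add: \<rho>_def)
    then have "res_delta N (h * int y + b + 1 + int l) = (res_delta N (\<rho> + 1 + int l) :: int)"
      by (simp only: res_delta_add_multiple)
    moreover have "int N dvd \<rho> + 1 + int l \<longleftrightarrow> \<rho> + 1 + int l = int N"
    proof
      assume "int N dvd \<rho> + 1 + int l"
      then have "int N dvd \<rho> + 1 + int l - int N" by simp
      moreover have "\<bar>\<rho> + 1 + int l - int N\<bar> < int N"
        using \<rho> that assms(2) by linarith
      ultimately show "\<rho> + 1 + int l = int N"
        using zdvd_imp_le[of "int N" "\<bar>\<rho> + 1 + int l - int N\<bar>"] by fastforce
    qed auto
    ultimately show ?thesis by (auto simp: res_delta_def)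
  qed
  moreover have "(\<Sum>l<nat h. of_bool (int l = int N - 1 - \<rho>) :: int) = of_bool (\<rho> + h \<ge> int N)"
  proof -
    have "int l = int N - 1 - \<rho> \<longleftrightarrow> l = nat (int N - 1 - \<rho>)" for l
      using \<rho> by auto
    then show ?thesis using \<rho> assms(1)
      by (auto simp: of_bool_def nat_less_iff)
  qed
  ultimately show ?thesis by simp
qed

text \<open>The pairs \<open>(pell_p k, pell_q k)\<close> are the convergents of the square root of 2.\<close>

definition pell_p :: "nat \<Rightarrow> int" where
  "pell_p k = int (f_seq (2 * k))"

definition pell_q :: "nat \<Rightarrow> int" where
  "pell_q k = int (f_seq (2 * k + 1) div 2)"

lemma f_seq_odd: "int (f_seq (2 * k + 1)) = 2 * pell_q k"
  using even_f_odd[of k] by (auto simp: pell_q_def elim!: evenE)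

lemma pell_0 [simp]: "pell_p 0 = 1" "pell_q 0 = 1"
  using f_rec(1,2) by (simp_all add: pell_p_def pell_q_def)

lemma pell_Suc [simp]:
  "pell_p (Suc k) = pell_p k + 2 * pell_q k" "pell_q (Suc k) = pell_p k + pell_q k"
proof -
  show p: "pell_p (Suc k) = pell_p k + 2 * pell_q k"
    using f_rec(3)[of k] f_seq_odd[of k] by (simp add: pell_p_def)
  have "2 * pell_q (Suc k) = pell_p k + pell_p (Suc k)"
    using f_rec(4)[of k] f_seq_odd[of "Suc k"] by (simp add: pell_p_def numeral_3_eq_3)
  then show "pell_q (Suc k) = pell_p k + pell_q k" using p by simp
qed

lemma pell_bounds: "1 \<le> pell_q k" "pell_q k \<le> pell_p k" "pell_p k < 2 * pell_q k"
  by (induction k) auto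

lemma pell_parity: "odd (pell_p k)" "even (pell_q k) \<longleftrightarrow> odd k"
  by (induction k) auto

lemma pell_equation: "pell_p k * pell_p k = 2 * pell_q k * pell_q k - (-1) ^ k"
  by (induction k) (auto simp: algebra_simps)

text \<open>The solution, with initial value 1, of the recursion sending b to N + h - 1 - b, where N
  = \<open>2 * pell_q k\<close> and h = \<open>pell_p k\<close>.\<close>

definition intercept :: "nat \<Rightarrow> int" where
  "intercept k = pell_q k - of_bool (odd k)"

text \<open>The range grows to \<open>L + 2 * ones L + 1\<close>. The coding at L itself, combined
  with the Pell equation, determines \<open>ones L\<close>, and this gives the range in closed
  form.\<close>

lemma coded_upto_pell:
  "coded_upto (2 * pell_q k) (pell_p k) (intercept k) (nat (3 * pell_q k + pell_p k - 1))"
proof (induction k)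
  case 0
  have "s_letter 0" "\<not> s_letter 1" "s_letter 2"
    by (simp_all add: s_letter_def numeral_2_eq_2)
  then have "ones 1 = 1" "ones 2 = 1" "ones 3 = 2"
    by (simp_all add: numeral_2_eq_2 numeral_3_eq_3)
  moreover have "y \<in> {0, 1, 2, 3}" if "y \<le> 3" for y :: nat
    using that by auto
  ultimately show ?case
    by (fastforce simp: coded_upto_def intercept_def)
next
  case (Suc k)
  define p q b where "p = pell_p k" and "q = pell_q k" and "b = intercept k"
  define L where "L = nat (3 * q + p - 1)"
  have bds: "1 \<le> q" "q \<le> p" "p < 2 * q" using pell_bounds[of k] by (simp_all add: p_def q_def)
  have L: "int L = 3 * q + p - 1" using bds by (simp add: L_def)
  have coded: "coded_upto (2 * q) p b L" using Suc by (simp add: p_def q_def b_def L_def)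
  have eq: "p * p = 2 * q * q - (-1) ^ k" by (simp add: p_def q_def pell_equation)
  \<comment> \<open>Inserting L and the Pell equation into the coding bounds at L leaves q w \<le> r
    < q w + 2 q. With 0 \<le> r < 2 q this forces -2 < w < 2, and w is even since p is odd; so w =
    0.\<close>
  define r where "r = q + b - p - (-1) ^ k"
  have r: "0 \<le> r" "r < 2 * q"
    using bds by (auto simp: r_def b_def intercept_def q_def)
  define w where "w = 2 * int (ones L) - (3 * p + 2 * q - 1)"
  have "2 * q * int (ones L) \<le> p * int L + b" "p * int L + b < 2 * q * int (ones L) + 2 * q"
    using coded by (auto simp: coded_upto_def)
  then have "q * w \<le> r" "r < q * w + 2 * q"
    unfolding L w_def r_def using eq by (simp_all add: algebra_simps)
  then have "q * w < q * 2" "q * (-2) < q * w"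
    using r by linarith+
  moreover have "0 < q" using bds(1) by simp
  ultimately have "w < 2" "-2 < w"
    by (simp_all only: mult_less_cancel_left_pos)
  moreover have "even w" using pell_parity(1)[of k] by (simp add: w_def p_def)
  ultimately have "w = 0" by presburger
  then have "L + 2 * ones L + 1 = nat (3 * pell_q (Suc k) + pell_p (Suc k) - 1)"
    using L bds by (simp add: w_def flip: p_def q_def)
  moreover have "2 * q + p - 1 - b = intercept (Suc k)"
    by (auto simp: b_def intercept_def p_def q_def)
  moreover have "coded_upto (2 * q + 2 * p) (2 * q + p) (2 * q + p - 1 - b) (L + 2 * ones L + 1)"
    using bds by (intro coded_upto_step coded) auto
  moreover have "2 * q + 2 * p = 2 * pell_q (Suc k)" "2 * q + p = pell_p (Suc k)"
    by (simp_all add: p_def q_def)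
  ultimately show ?case by (simp only:)
qed

text \<open>The rows are reversed to turn the Hankel matrix into a Toeplitz matrix. The window must lie
  in the range where the \<open>N\<close>-periodic coding is valid; then this Toeplitz matrix is a circulant of
  order \<open>N\<close> without its last row and column.\<close>

lemma hankel_eq_circulant_minor:
  assumes coded: "coded_upto (int N) h b L" and h: "0 \<le> h" "h \<le> int N"
    and N: "N \<ge> 2" and L: "m + 2 * (N - 2) < L"
    and inv: "h * int h' = 1 + int q * int N"
    and a: "int N dvd h * (int m - 2 + int a) + b + 1"
  shows "(-1) ^ ((N - 1) * (N - 2) div 2) * hankel m (N - 1)
      = det (mat (N - 1) (N - 1) (\<lambda>(i, j). \<Sum>l<nat h. res_delta N (int j - int i - int a + int h' * int l)))"
proof -
  define n where "n = N - 1"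
  \<comment> \<open>Multiplication by h, a unit modulo N, translates between positions on the circle
    and powers of the shift; the hypothesis on \<open>a\<close> aligns their origins.\<close>
  define A where "A = mat n n (\<lambda>(i, j). s_seq (m + i + j))"
  have "coprime (int N) h"
  proof (rule coprimeI)
    fix u assume "u dvd h" "u dvd int N"
    then have "u dvd h * int h' - int q * int N" by (intro dvd_diff) auto
    then show "u dvd 1" by (simp add: inv)
  qed
  have "s_seq (m + (n - 1 - i) + j) = (\<Sum>l<nat h. res_delta N (int j - int i - int a + int h' * int l))"
    if "i < n" "j < n" for i j
  proof -
    define y where "y = m + (n - 1 - i) + j"
    have "y < L" using that L by (simp add: y_def n_def)
    have y: "int y = int m + int N - 2 - int i + int j"
      using that by (simp add: y_def n_def)
    have "int N dvd h * int y + b + 1 + int l \<longleftrightarrow> int N dvd int j - int i - int a + int h' * int l" for l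
    proof -
      define x where "x = int j - int i - int a + int h' * int l"
      have "h * x = h * (int j - int i - int a) + (h * int h') * int l"
        by (simp add: x_def algebra_simps)
      then have "h * int y + b + 1 + int l
          = (h * (int m - 2 + int a) + b + 1 + int N * (h - int q * int l)) + h * x"
        by (simp add: y inv algebra_simps)
      moreover have "int N dvd h * (int m - 2 + int a) + b + 1 + int N * (h - int q * int l)"
        by (rule dvd_add[OF a]) simp
      ultimately have "int N dvd h * int y + b + 1 + int l \<longleftrightarrow> int N dvd h * x"
        by (simp only: dvd_add_right_iff)
      also have "\<dots> \<longleftrightarrow> int N dvd x"
        using \<open>coprime (int N) h\<close> by (simp add: coprime_dvd_mult_right_iff)
      finally show ?thesis by (simp add: x_def)
    qed
    then show ?thesis
      unfolding y_def[symmetric] s_seq_def s_letter_coded[OF h coded \<open>y < L\<close>]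
      by (simp add: res_delta_def)
  qed
  then have "mat n n (\<lambda>(i, j). A $$ (n - 1 - i, j))
      = mat n n (\<lambda>(i, j). \<Sum>l<nat h. res_delta N (int j - int i - int a + int h' * int l))"
    by (intro eq_matI) (auto simp: A_def)
  moreover have "det (mat n n (\<lambda>(i, j). A $$ (n - 1 - i, j))) = (-1) ^ (n * (n - 1) div 2) * det A"
    by (rule det_reverse_rows) (simp add: A_def)
  ultimately show ?thesis
    by (simp add: n_def A_def hankel_def numeral_2_eq_2)
qed

theorem theorem5:
  fixes k :: nat
  assumes "k \<ge> 1"
  shows "hankel (f_seq (2 * k + 1) div 2 + 1) (f_seq (2 * k + 3) - 1)
           = (-1) ^ (k + 1) * int (f_seq (2 * k + 1) div 2)"
proof -
  \<comment> \<open>Index \<open>Suc k\<close> makes 2 q = \<open>f_seq (2 * k + 3)\<close>, so the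
    order is 2 q - 1; the expected absolute value is then p - q.\<close>
  define p q where "p = nat (pell_p (Suc k))" and "q = nat (pell_q (Suc k))"
  define m where "m = f_seq (2 * k + 1) div 2 + 1"
  have ip: "int p = pell_p (Suc k)" and iq: "int q = pell_q (Suc k)"
    using pell_bounds[of "Suc k"] by (simp_all add: p_def q_def)
  have bds: "1 \<le> q" "q \<le> p" "p < 2 * q"
    using pell_bounds[of "Suc k"] by (simp_all only: flip: ip iq)
  have prev: "pell_q k = int p - int q"
    by (simp add: ip iq)
  have m: "int m = int p - int q + 1"
    using prev by (simp add: m_def pell_q_def)
  have N: "f_seq (2 * k + 3) = 2 * q"
    using f_seq_odd[of "Suc k"] by (simp add: numeral_3_eq_3 del: pell_Suc flip: iq)
  have odd_p: "odd p" and even_q: "even q \<longleftrightarrow> even k"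
    using pell_parity[of "Suc k"] by (simp_all flip: ip iq del: pell_Suc)
  have eq: "int p * int p = 2 * int q * int q + (-1) ^ k"
    using pell_equation[of "Suc k"] by (simp flip: ip iq del: pell_Suc)
  have coded: "coded_upto (int (2 * q)) (int p) (intercept (Suc k)) (3 * q + p - 1)"
  proof -
    have "nat (3 * int q + int p - 1) = 3 * q + p - 1"
      using bds by linarith
    then show ?thesis
      using coded_upto_pell[of "Suc k"] by (simp del: pell_Suc flip: ip iq)
  qed
  \<comment> \<open>The largest index in the matrix is 3 q + p - 3.\<close>
  have window: "m + 2 * (2 * q - 2) < 3 * q + p - 1"
    using m bds by linarith
  \<comment> \<open>By the Pell equation, p is its own inverse modulo 2 q for even k, while for odd
    k the inverse is -p, represented by 2 q - p.\<close>
  have "\<exists>a h' r. int p * int h' = 1 + int r * int (2 * q)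
      \<and> int (2 * q) dvd int p * (int m - 2 + int a) + intercept (Suc k) + 1
      \<and> (-1) ^ a * (int p * (\<Sum>i<h'. res_delta (2 * q) (int a + int i)) - int r) = int p - int q"
  proof (cases "even k")
    case True
    \<comment> \<open>This makes m - 2 + a equal to q, and the phase becomes q (p + 1), a multiple
      of 2 q as p is odd. The p consecutive integers from a end exactly at 2 q, so the diagonal sum
      is 1.\<close>
    define a where "a = 2 * q + 1 - p"
    have a: "int a = 2 * int q + 1 - int p" using bds by (simp add: a_def)
    have "int p * int p = 1 + int q * int (2 * q)"
      using eq True by simp
    moreover have "int (2 * q) dvd int p * (int m - 2 + int a) + intercept (Suc k) + 1"
    proof -
      have "int p * (int m - 2 + int a) + intercept (Suc k) + 1 = int q * (int p + 1)"
        using True by (simp add: m a intercept_def algebra_simps del: pell_Suc flip: iq)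
      moreover have "even (int p + 1)" using odd_p by simp
      then obtain c where "int p + 1 = 2 * c" ..
      ultimately show ?thesis by simp
    qed
    moreover have "even a" using odd_p bds by (simp add: a_def)
    moreover have "(\<Sum>i<p. res_delta (2 * q) (int a + int i)) = (1 :: int)"
    proof -
      have "int (2 * q) dvd int a + int i \<longleftrightarrow> i = p - 1" if "i < p" for i
      proof
        assume "int (2 * q) dvd int a + int i"
        then have "int (2 * q) \<le> int a + int i" using a bds by (intro zdvd_imp_le) auto
        then show "i = p - 1" using a that by linarith
      qed (use a bds in auto)
      then have "(\<Sum>i<p. res_delta (2 * q) (int a + int i)) = (\<Sum>i<p. of_bool (i = p - 1) :: int)"
        by (intro sum.cong) (simp_all add: res_delta_def)
      then show ?thesis using bds by (simp add: of_bool_def)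
    qed
    ultimately show ?thesis by (intro exI[of _ a] exI[of _ p] exI[of _ q]) simp
  next
    case False
    define h' r where "h' = 2 * q - p" and "r = p - q"
    have hr: "int h' = 2 * int q - int p" "int r = int p - int q"
      using bds by (simp_all add: h'_def r_def)
    have "int p * int h' = 1 + int r * int (2 * q)"
      using eq False by (simp add: hr algebra_simps)
    moreover have "int (2 * q) dvd int p * (int m - 2 + int 1) + intercept (Suc k) + 1"
    proof -
      have "odd (int p)" using odd_p by simp
      then obtain c where c: "int p = 2 * c + 1" by (rule oddE)
      have "int p * (int m - 2 + int 1) + intercept (Suc k) + 1 = 2 * int q * int q - int q * (int p - 1)"
        using False eq by (simp add: m intercept_def algebra_simps del: pell_Suc flip: iq)
      also have "\<dots> = int (2 * q) * (int q - c)" by (simp add: c algebra_simps)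
      finally show ?thesis by simp
    qed
    \<comment> \<open>With a = 1 the integers 1, ..., 2 q - p all lie below 2 q; the odd a then
      changes the sign of -r = q - p.\<close>
    moreover have "(\<Sum>i<h'. res_delta (2 * q) (int 1 + int i)) = (0 :: int)"
    proof (rule sum.neutral, rule ballI)
      fix i assume "i \<in> {..<h'}"
      then have "\<not> int (2 * q) dvd int 1 + int i"
        using bds by (intro zdvd_not_zless) (auto simp: h'_def)
      then show "res_delta (2 * q) (int 1 + int i) = (0 :: int)" by (simp add: res_delta_def)
    qed
    ultimately show ?thesis by (intro exI[of _ 1] exI[of _ h'] exI[of _ r]) (simp add: hr)
  qed
  then obtain a h' r where inv: "int p * int h' = 1 + int r * int (2 * q)"
    and a: "int (2 * q) dvd int p * (int m - 2 + int a) + intercept (Suc k) + 1"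
    and val: "(-1) ^ a * (int p * (\<Sum>i<h'. res_delta (2 * q) (int a + int i)) - int r) = int p - int q"
    by blast
  have N2: "2 * q \<ge> 2" using bds by simp
  have "(-1) ^ ((2 * q - 1) * (2 * q - 2) div 2) * hankel m (2 * q - 1)
      = det (mat (2 * q - 1) (2 * q - 1) (\<lambda>(i, j). \<Sum>l<nat (int p). res_delta (2 * q) (int j - int i - int a + int h' * int l)))"
    using bds by (intro hankel_eq_circulant_minor[OF coded _ _ N2 window inv a]) auto
  also have "\<dots> = int p - int q"
    using det_circulant_progression_minor[OF N2 _ inv, of a] val by simp
  finally have "(-1) ^ ((2 * q - 1) * (2 * q - 2) div 2) * hankel m (2 * q - 1) = int p - int q" .
  moreover have "(-1 :: int) ^ ((2 * q - 1) * (2 * q - 2) div 2) = (-1) ^ (k + 1)"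
  proof -
    \<comment> \<open>The exponent is (2 q - 1) (q - 1), whose parity is that of q - 1, and q is
      even exactly when k is.\<close>
    obtain u where u: "q = Suc u" using bds by (cases q) auto
    have "(2 * q - 1) * (2 * q - 2) div 2 = (2 * q - 1) * u"
      by (simp add: u)
    moreover have "even u \<longleftrightarrow> odd k" using even_q by (auto simp: u)
    ultimately show ?thesis by (auto simp: minus_one_power_iff u)
  qed
  ultimately have "(-1) ^ (k + 1) * ((-1) ^ (k + 1) * hankel m (2 * q - 1)) = (-1) ^ (k + 1) * (int p - int q)"
    by (simp only:)
  then have "hankel m (2 * q - 1) = (-1) ^ (k + 1) * (int p - int q)"
    by (simp add: power_mult_distrib[symmetric] mult.assoc[symmetric] flip: power_add)
  then show ?thesis
    using prev by (simp add: m_def N pell_q_def)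
qed

end
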